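(* Suppose $\|g(x)-g(y)\|\le\kappa\|x-y\|$ for all $x,y\in\mathbb{R}^d$ with $\kappa<1$, and $\|g'(x)-g'(y)\|\le\gamma\|x-y\|$ for all $x,y\in\mathbb{R}^d$ with $\gamma>0$. Let $\{x_t\}$ be generated by AAP($m$) with damping ratios satisfying $\beta_t\ge\beta>0$ for some $\beta$, and with $S_t$ and $Y_t$ of full column rank for all $t\ge 0$; suppose there exist constants $T>0$ and $M>0$ such that $\mathrm{cond}(S_t)\le M$ for all $t>T$. Let $x^*$ be the fixed-point solution, i.e., $x^*=g(x^* )$. For any constant $\rho$ satisfying $$\sup_t\left[(1-\beta_t)+\beta_t\kappa\right]\theta_t<\rho<1,$$ there exists $x_0$ sufficiently close to $x^*$ such that $f_t$ converges $q$-linearly to $f(x^* )=0$, i.e., $$\|f_{t+1}\|\le\rho\,\|f_t\| .$$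
   Context: $g:\mathbb{R}^d\to\mathbb{R}^d$ is continuously differentiable, with Jacobian $g'$, and $f(x):=g(x)-x$. $\|\cdot\|$ is the Euclidean norm for vectors and the induced 2-norm for matrices; $\mathrm{cond}$ is the 2-norm condition number (ratio of largest to smallest singular value). AAP($m$) (Alternating Anderson-Picard method), with integer $1\le m\le d$, damping ratios $\beta_t\ge 0$ and starting point $x_0\in\mathbb{R}^d$: for $t=0,1,2,\dots$ set $x_t^0:=x_t$, $x_t^{\ell}:=g(x_t^{\ell-1})$ for $1\le\ell\le m$, $f_t^\ell:=f(x_t^\ell)$ for $0\le\ell\le m$, and $f_t:=f_t^0=f(x_t)$. Let $\alpha_t=(\alpha_t^0,\dots,\alpha_t^m)\in\mathbb{R}^{m+1}$ minimize $\|\sum_{\ell=0}^m\alpha^\ell f_t^\ell\|^2$ subject to $\sum_{\ell=0}^m\alpha^\ell=1$, and set $x_{t+1}:=(1-\beta_t)\sum_{\ell=0}^m\alpha_t^\ell x_t^\ell+\beta_t\sum_{\ell=0}^m\alpha_t^\ell g(x_t^\ell)$. $S_t:=[s_t^0,\dots,s_t^{m-1}]$ and $Y_t:=[y_t^0,\dots,y_t^{m-1}]$ in $\mathbb{R}^{d\times m}$, where $s_t^\ell:=x_t^{\ell+1}-x_t^\ell$ and $y_t^\ell:=f_t^{\ell+1}-f_t^\ell$. (Full column rank of $S_t$ forces $f_t=s_t^0\neq 0$.) Optimization gain: $\theta_t:=\|\sum_{\ell=0}^m\alpha_t^\ell f_t^\ell\|/\|f_t\|$.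
   Formalization: The factor (1-β_t) is replaced by |1-β_t| (the claim fails for large β_t); cond(S_t) for t≤T is bounded by an arbitrary constant C; the claim holds for every x_0 within δ of x*, where δ may depend on C and on a number q<ρ bounding the sup. *)

theory Defs
  imports "HOL-Analysis.Analysis"
begin

section \<open>Matrices given by their columns\<close>

text \<open>
  A real \<open>d \<times> m\<close> matrix, with \<open>m\<close> a natural number, is given by its columns
  \<open>A 0, \<dots>, A (m - 1) :: real ^ 'n\<close>, where \<open>d = CARD('n)\<close>; the values \<open>A j\<close> for
  \<open>j \<ge> m\<close> are irrelevant.
\<close>

definition full_column_rank :: "nat \<Rightarrow> (nat \<Rightarrow> real ^ 'n) \<Rightarrow> bool" where
  "full_column_rank m A \<longleftrightarrow> dim (A ` {..<m}) = m"

text \<open>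
  The singular values of \<open>A\<close> (for \<open>m \<le> d\<close>) are the square roots of the eigenvalues of
  the \<open>m \<times> m\<close> matrix \<open>A\<^sup>T A\<close>, whose \<open>(i, j)\<close> entry is \<open>A i \<bullet> A j\<close>.
\<close>

definition singular_values :: "nat \<Rightarrow> (nat \<Rightarrow> real ^ 'n) \<Rightarrow> real set" where
  "singular_values m A =
     {\<sigma>. 0 \<le> \<sigma> \<and>
        (\<exists>v :: nat \<Rightarrow> real. (\<exists>j<m. v j \<noteq> 0) \<and>
           (\<forall>i<m. (\<Sum>j<m. (A i \<bullet> A j) * v j) = \<sigma>\<^sup>2 * v i))}"

text \<open>
  This is meaningful only for matrices of full column rank with \<open>1 \<le> m \<le> d\<close>; otherwise the
  denominator may vanish, and division by zero yields \<open>0\<close>.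
\<close>

definition cond_number :: "nat \<Rightarrow> (nat \<Rightarrow> real ^ 'n) \<Rightarrow> real" where
  "cond_number m A = Max (singular_values m A) / Min (singular_values m A)"


section \<open>The alternating Anderson-Picard method\<close>

definition residual :: "(real ^ 'n \<Rightarrow> real ^ 'n) \<Rightarrow> real ^ 'n \<Rightarrow> real ^ 'n" where
  "residual g x = g x - x"

text \<open>
  Throughout, \<open>x\<close> is an outer iterate \<open>x\<^sub>t\<close>, so that the inner iterate \<open>x\<^sub>t\<^sup>l\<close> is
  \<open>(g ^^ l) x\<close>, and \<open>a\<close> is a weight vector \<open>\<alpha>\<^sub>t\<close>, of which only \<open>a 0, \<dots>, a m\<close> matter.
\<close>

definition mixed_residual ::
    "(real ^ 'n \<Rightarrow> real ^ 'n) \<Rightarrow> nat \<Rightarrow> real ^ 'n \<Rightarrow> (nat \<Rightarrow> real) \<Rightarrow> real ^ 'n" where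
  "mixed_residual g m x a = (\<Sum>l\<le>m. a l *\<^sub>R residual g ((g ^^ l) x))"

definition aap_weights ::
    "(real ^ 'n \<Rightarrow> real ^ 'n) \<Rightarrow> nat \<Rightarrow> real ^ 'n \<Rightarrow> (nat \<Rightarrow> real) \<Rightarrow> bool" where
  "aap_weights g m x a \<longleftrightarrow>
     is_arg_min (\<lambda>a. (norm (mixed_residual g m x a))\<^sup>2) (\<lambda>a. (\<Sum>l\<le>m. a l) = 1) a"

definition aap_step ::
    "(real ^ 'n \<Rightarrow> real ^ 'n) \<Rightarrow> nat \<Rightarrow> real \<Rightarrow> real ^ 'n \<Rightarrow> (nat \<Rightarrow> real) \<Rightarrow> real ^ 'n" where
  "aap_step g m b x a =
     (1 - b) *\<^sub>R (\<Sum>l\<le>m. a l *\<^sub>R (g ^^ l) x) + b *\<^sub>R (\<Sum>l\<le>m. a l *\<^sub>R g ((g ^^ l) x))"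

definition aap_sequence ::
    "(real ^ 'n \<Rightarrow> real ^ 'n) \<Rightarrow> nat \<Rightarrow> (nat \<Rightarrow> real) \<Rightarrow> (nat \<Rightarrow> nat \<Rightarrow> real) \<Rightarrow>
     (nat \<Rightarrow> real ^ 'n) \<Rightarrow> bool" where
  "aap_sequence g m b \<alpha> x \<longleftrightarrow>
     (\<forall>t. 0 \<le> b t \<and> aap_weights g m (x t) (\<alpha> t) \<and>
          x (Suc t) = aap_step g m (b t) (x t) (\<alpha> t))"

definition S_cols :: "(real ^ 'n \<Rightarrow> real ^ 'n) \<Rightarrow> real ^ 'n \<Rightarrow> nat \<Rightarrow> real ^ 'n" where
  "S_cols g x l = (g ^^ Suc l) x - (g ^^ l) x"

definition Y_cols :: "(real ^ 'n \<Rightarrow> real ^ 'n) \<Rightarrow> real ^ 'n \<Rightarrow> nat \<Rightarrow> real ^ 'n" where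
  "Y_cols g x l = residual g ((g ^^ Suc l) x) - residual g ((g ^^ l) x)"

definition gain ::
    "(real ^ 'n \<Rightarrow> real ^ 'n) \<Rightarrow> nat \<Rightarrow> real ^ 'n \<Rightarrow> (nat \<Rightarrow> real) \<Rightarrow> real" where
  "gain g m x a = norm (mixed_residual g m x a) / norm (residual g x)"

end

theory Submission imports Defs begin

text \<open>
  Write \<open>\<alpha>\<close> for the weights, \<open>xb = \<Sum>\<^sub>l \<alpha>\<^sub>l x\<^sup>l\<close> and \<open>fb = \<Sum>\<^sub>l \<alpha>\<^sub>l f\<^sup>l\<close>.  The next residual is exactly
  \<open>(1 - b) fb + (g (xb + b fb) - g xb) + E\<close> with \<open>E = g xb - \<Sum>\<^sub>l \<alpha>\<^sub>l g x\<^sup>l\<close>, so its norm is at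
  most \<open>(\<bar>1 - b\<bar> + b \<kappa>) \<theta> \<parallel>f\<parallel> + \<parallel>E\<parallel>\<close>, and everything rests on \<open>\<parallel>E\<parallel> = O(\<parallel>f\<parallel>\<^sup>2)\<close>.
  Abel summation gives \<open>xb = x + S c\<close> and \<open>fb = f + Y c\<close> with \<open>c\<^sub>j = \<Sum>\<^sub>l\<^sub>>\<^sub>j \<alpha>\<^sub>l\<close>.  Bounding \<open>S\<close> and
  \<open>c\<close> by the extremal singular values yields \<open>\<parallel>s\<^sup>j\<parallel> \<bar>c\<^sub>j\<bar> \<le> cond S \<sqdot> \<parallel>S c\<parallel>\<close>, hence \<open>Y c\<close> differs
  from \<open>(g' x - I) S c\<close> by \<open>O(\<parallel>f\<parallel> \<parallel>S c\<parallel>)\<close>.  Since \<open>\<parallel>Y c\<parallel> \<le> 2 \<parallel>f\<parallel>\<close> by minimality of the weights,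
  \<open>\<parallel>S c\<parallel> = O(\<parallel>f\<parallel>)\<close> for small \<open>f\<close>, and the Lipschitz continuity of \<open>g'\<close> gives the bound on \<open>E\<close>.
\<close>

section \<open>Extremal singular values\<close>

text \<open>A quadratic in \<open>e\<close> without constant term that is never negative has a
  minimum at \<open>0\<close>, so its derivative there vanishes.\<close>

lemma linear_coefficient_zero:
  fixes B D :: real
  assumes "\<And>e. 0 \<le> e * B + e\<^sup>2 * D"
  shows "B = 0"
proof (rule ccontr)
  assume "B \<noteq> 0"
  define p where "p = \<bar>D\<bar> + 1"
  have p: "p > 0" "D < p" by (auto simp: p_def)
  \<comment> \<open>The test point is \<open>e = - B / p\<close>: \<open>p > D\<close> lets the
    linear term win, and the factor \<open>p\<^sup>2\<close> clears denominators.\<close>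
  have "0 \<le> p\<^sup>2 * ((- B / p) * B + (- B / p)\<^sup>2 * D)"
    by (rule mult_nonneg_nonneg[OF zero_le_power2 assms])
  also have "\<dots> = B\<^sup>2 * (D - p)"
    using p by (simp add: field_simps power2_eq_square)
  also have "\<dots> < 0"
    using p \<open>B \<noteq> 0\<close> by (simp add: mult_pos_neg)
  finally show False by simp
qed

text \<open>First-order optimality: the quadratic form vanishes at \<open>w\<close>, so along
  \<open>w + e *\<^sub>R u\<close> only terms linear and quadratic in \<open>e\<close> remain, and
  the linear one must be zero.\<close>

lemma Rayleigh_critical:
  fixes h :: "'a::real_inner \<Rightarrow> 'b::real_inner" and r \<mu> :: real
  assumes h: "linear h" and W: "subspace W" and w: "w \<in> W" and u: "u \<in> W" and r: "r \<noteq> 0"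
    and nonneg: "\<And>v. v \<in> W \<Longrightarrow> 0 \<le> r * ((norm (h v))\<^sup>2 - \<mu> * (norm v)\<^sup>2)"
    and eq: "(norm (h w))\<^sup>2 = \<mu> * (norm w)\<^sup>2"
  shows "h w \<bullet> h u = \<mu> * (w \<bullet> u)"
proof -
  have "r * (2 * (h w \<bullet> h u - \<mu> * (w \<bullet> u))) = 0"
  proof (rule linear_coefficient_zero)
    fix e :: real
    have "w + e *\<^sub>R u \<in> W"
      using W w u by (simp add: subspace_add subspace_scale)
    from nonneg[OF this]
    have "0 \<le> r * ((norm (h w + e *\<^sub>R h u))\<^sup>2 - \<mu> * (norm (w + e *\<^sub>R u))\<^sup>2)"
      by (simp add: linear_add[OF h] linear_scale[OF h])
    also have "\<dots> = e * (r * (2 * (h w \<bullet> h u - \<mu> * (w \<bullet> u))))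
        + e\<^sup>2 * (r * ((norm (h u))\<^sup>2 - \<mu> * (norm u)\<^sup>2))
        + r * ((norm (h w))\<^sup>2 - \<mu> * (norm w)\<^sup>2)"
      unfolding power2_norm_eq_inner
      by (simp add: inner_simps inner_commute algebra_simps power2_eq_square)
    finally show "0 \<le> e * (r * (2 * (h w \<bullet> h u - \<mu> * (w \<bullet> u))))
        + e\<^sup>2 * (r * ((norm (h u))\<^sup>2 - \<mu> * (norm u)\<^sup>2))"
      by (simp add: eq)
  qed
  with r show ?thesis by simp
qed

text \<open>The sign of \<open>r\<close> selects between the smallest and the largest singular value.\<close>

lemma Rayleigh_extremal:
  fixes h :: "'a::euclidean_space \<Rightarrow> 'b::real_inner" and r :: real
  assumes h: "linear h" and W: "subspace W" and "W \<noteq> {0}" and r: "r \<noteq> 0"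
  obtains w where "w \<in> W" "norm w = 1"
    "\<And>v. v \<in> W \<Longrightarrow> 0 \<le> r * ((norm (h v))\<^sup>2 - (norm (h w))\<^sup>2 * (norm v)\<^sup>2)"
    "\<And>u. u \<in> W \<Longrightarrow> h w \<bullet> h u = (norm (h w))\<^sup>2 * (w \<bullet> u)"
proof -
  have normalize: "v /\<^sub>R norm v \<in> W \<inter> sphere 0 1" if "v \<in> W" "v \<noteq> 0" for v
    using W that by (simp add: subspace_scale)
  obtain v where "v \<in> W" "v \<noteq> 0"
    using \<open>W \<noteq> {0}\<close> subspace_0[OF W] by blast
  then have "W \<inter> sphere 0 1 \<noteq> {}" using normalize by blast
  moreover have "compact (W \<inter> sphere 0 1)"
    by (simp add: closed_Int_compact closed_subspace[OF W])
  moreover have "continuous_on (W \<inter> sphere 0 1) (\<lambda>v. r * (norm (h v))\<^sup>2)"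
    using linear_continuous_on[OF h[THEN linear_conv_bounded_linear[THEN iffD1]]]
    by (intro continuous_intros) auto
  ultimately obtain w where w: "w \<in> W \<inter> sphere 0 1"
    and min: "\<And>v. v \<in> W \<inter> sphere 0 1 \<Longrightarrow> r * (norm (h w))\<^sup>2 \<le> r * (norm (h v))\<^sup>2"
    using continuous_attains_inf[of "W \<inter> sphere 0 1"] by blast
  \<comment> \<open>Homogeneity of degree two carries the minimum on the unit sphere over to all of
    \<open>W\<close>.\<close>
  have nonneg: "0 \<le> r * ((norm (h v))\<^sup>2 - (norm (h w))\<^sup>2 * (norm v)\<^sup>2)" if "v \<in> W" for v
  proof (cases "v = 0")
    case True
    then show ?thesis by (simp add: linear_0[OF h])
  next
    case False
    have "0 \<le> (norm v)\<^sup>2 * (r * (norm (h (v /\<^sub>R norm v)))\<^sup>2 - r * (norm (h w))\<^sup>2)"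
      using min[OF normalize[OF that False]] by (intro mult_nonneg_nonneg) auto
    also have "\<dots> = r * ((norm (h v))\<^sup>2 - (norm (h w))\<^sup>2 * (norm v)\<^sup>2)"
      using False by (simp add: linear_scale[OF h] field_simps power_mult_distrib)
    finally show ?thesis .
  qed
  show ?thesis
  proof (rule that[of w])
    show "h w \<bullet> h u = (norm (h w))\<^sup>2 * (w \<bullet> u)" if "u \<in> W" for u
      using w that r nonneg by (intro Rayleigh_critical[OF h W]) auto
  qed (use w nonneg in auto)
qed

section \<open>Full column rank, singular values and the condition number\<close>

lemma full_column_rank_imp:
  fixes A :: "nat \<Rightarrow> real ^ 'n"
  assumes "full_column_rank m A"
  shows "m \<le> CARD('n)" "\<And>c. (\<Sum>j<m. c j *\<^sub>R A j) = 0 \<Longrightarrow> \<forall>j<m. c j = 0"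
proof -
  have d: "dim (A ` {..<m}) = m"
    using assms by (simp add: full_column_rank_def)
  then show "m \<le> CARD('n)"
    using dim_subset_UNIV[of "A ` {..<m}"] by simp
  \<comment> \<open>The rank is that of the set of columns, so repeated columns must be excluded
    before coefficients can be indexed by vectors.\<close>
  have "card (A ` {..<m}) = m"
    using dim_le_card'[of "A ` {..<m}"] card_image_le[of "{..<m}" A] d by simp
  then have inj: "inj_on A {..<m}"
    by (simp add: eq_card_imp_inj_on)
  have ind: "independent (A ` {..<m})"
    using d inj by (intro card_le_dim_spanning[of _ "A ` {..<m}"])
      (auto simp: card_image span_superset)
  fix c assume c: "(\<Sum>j<m. c j *\<^sub>R A j) = 0"
  define c' where "c' v = c (the_inv_into {..<m} A v)" for v
  have "(\<Sum>v\<in>A ` {..<m}. c' v *\<^sub>R v) = 0"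
    using c inj by (simp add: sum.reindex c'_def the_inv_into_f_f)
  then have "\<forall>v\<in>A ` {..<m}. c' v = 0"
    using ind by (auto simp: independent_explicit)
  then show "\<forall>j<m. c j = 0"
    using inj by (auto simp: c'_def the_inv_into_f_f)
qed

lemma inner_sum_columns:
  fixes A :: "nat \<Rightarrow> 'a::real_inner"
  shows "A i \<bullet> (\<Sum>j<m. v j *\<^sub>R A j) = (\<Sum>j<m. (A i \<bullet> A j) * v j)"
  by (simp add: inner_sum_right mult.commute)

text \<open>
  Finiteness: \<open>A\<close> maps eigenvectors of \<open>A\<^sup>T A\<close> for distinct eigenvalues to nonzero orthogonal vectors.
\<close>

lemma finite_pos_singular_values:
  fixes A :: "nat \<Rightarrow> real ^ 'n"
  assumes A: "full_column_rank m A"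
  shows "finite (singular_values m A)" "\<And>\<sigma>. \<sigma> \<in> singular_values m A \<Longrightarrow> 0 < \<sigma>"
proof -
  define S where "S = singular_values m A"
  have "\<forall>\<sigma>\<in>S. \<exists>v. (\<exists>j<m. v j \<noteq> 0) \<and> (\<forall>i<m. (\<Sum>j<m. (A i \<bullet> A j) * v j) = \<sigma>\<^sup>2 * v i)"
    by (auto simp: S_def singular_values_def)
  then obtain V where V: "\<And>\<sigma>. \<sigma> \<in> S \<Longrightarrow> \<exists>j<m. V \<sigma> j \<noteq> 0"
    and ev: "\<And>\<sigma> i. \<sigma> \<in> S \<Longrightarrow> i < m \<Longrightarrow> (\<Sum>j<m. (A i \<bullet> A j) * V \<sigma> j) = \<sigma>\<^sup>2 * V \<sigma> i"
    by metis
  define z where "z \<sigma> = (\<Sum>j<m. V \<sigma> j *\<^sub>R A j)" for \<sigma>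
  have nz: "z \<sigma> \<noteq> 0" if "\<sigma> \<in> S" for \<sigma>
    using full_column_rank_imp(2)[OF A, of "V \<sigma>"] V[OF that] by (auto simp: z_def)
  \<comment> \<open>Only the eigenvalue equation for \<open>\<sigma>\<close> enters. Exchanging the
    roles gives a second value of the same inner product, which forces orthogonality for distinct
    eigenvalues.\<close>
  have z: "z \<tau> \<bullet> z \<sigma> = \<sigma>\<^sup>2 * (\<Sum>i<m. V \<tau> i * V \<sigma> i)" if "\<sigma> \<in> S" for \<sigma> \<tau>
  proof -
    have "z \<tau> \<bullet> z \<sigma> = (\<Sum>i<m. V \<tau> i * (A i \<bullet> z \<sigma>))"
      by (simp add: z_def[of \<tau>] inner_sum_left)
    also have "\<dots> = (\<Sum>i<m. V \<tau> i * (\<sigma>\<^sup>2 * V \<sigma> i))"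
      using ev[OF that] by (simp add: z_def inner_sum_columns)
    finally show ?thesis by (simp add: sum_distrib_left mult_ac)
  qed
  have pos: "0 < \<sigma>" if "\<sigma> \<in> S" for \<sigma>
    using z[OF that, of \<sigma>] nz[OF that] that by (cases "\<sigma> = 0") (auto simp: S_def singular_values_def)
  have orth: "z \<tau> \<bullet> z \<sigma> = 0" if "\<sigma> \<in> S" "\<tau> \<in> S" "\<sigma> \<noteq> \<tau>" for \<sigma> \<tau>
  proof -
    let ?p = "\<Sum>i<m. V \<tau> i * V \<sigma> i"
    have "\<sigma>\<^sup>2 * ?p = \<tau>\<^sup>2 * ?p"
      using z[OF that(1), of \<tau>] z[OF that(2), of \<sigma>]
      by (simp add: inner_commute[of "z \<sigma>"] mult.commute[of "V \<sigma> _"])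
    moreover have "\<sigma>\<^sup>2 \<noteq> \<tau>\<^sup>2"
      using that pos[of \<sigma>] pos[of \<tau>] by (simp add: power2_eq_iff)
    ultimately have "?p = 0" by simp
    then show ?thesis using z[OF that(1), of \<tau>] by simp
  qed
  have "inj_on z S"
    using orth nz by (metis inj_onI inner_eq_zero_iff)
  moreover have "independent (z ` S)"
  proof (rule pairwise_orthogonal_independent)
    show "pairwise orthogonal (z ` S)"
      using orth unfolding pairwise_def orthogonal_def by (metis (no_types, lifting) imageE)
    show "0 \<notin> z ` S"
      using nz by auto
  qed
  ultimately show "finite (singular_values m A)"
    using independent_imp_finite finite_imageD S_def by blast
  show "\<And>\<sigma>. \<sigma> \<in> singular_values m A \<Longrightarrow> 0 < \<sigma>"
    using pos S_def by blast
qed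

text \<open>A column is the image of a unit vector, so its norm is at most the largest singular
  value, while \<open>\<bar>c j\<bar>\<close> times the smallest is at most the norm of the
  combination. The product is insensitive to the scale of the columns, which matters because the
  increments shrink with the residual.\<close>

lemma cond_number_bound:
  fixes A :: "nat \<Rightarrow> real ^ 'n"
  assumes A: "full_column_rank m A" and ij: "i < m" "j < m"
  shows "norm (A i) * \<bar>c j\<bar> \<le> cond_number m A * norm (\<Sum>k<m. c k *\<^sub>R A k)"
proof -
  let ?S = "singular_values m A"
  have "\<exists>\<phi>. \<phi> ` {..<m} \<subseteq> (UNIV :: 'n set) \<and> inj_on \<phi> {..<m}"
    using full_column_rank_imp(1)[OF A] by (intro card_le_inj) auto
  then obtain \<phi> :: "nat \<Rightarrow> 'n" where \<phi>: "inj_on \<phi> {..<m}" by auto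
  \<comment> \<open>The space of coefficient vectors, realised as a coordinate subspace of the ambient one.\<close>
  define W where "W = {w :: real ^ 'n. \<forall>k. k \<notin> \<phi> ` {..<m} \<longrightarrow> w $ k = 0}"
  define h where "h w = (\<Sum>k<m. (w $ \<phi> k) *\<^sub>R A k)" for w :: "real ^ 'n"
  have W: "subspace W"
    by (auto simp: W_def subspace_def)
  have h: "linear h"
    by (auto simp: h_def linear_iff sum.distrib scaleR_sum_right algebra_simps)
  have axis_W: "axis (\<phi> k) 1 \<in> W" if "k < m" for k
    using that by (auto simp: W_def axis_def)
  have h_axis: "h (axis (\<phi> k) 1) = A k" if "k < m" for k
  proof -
    have "h (axis (\<phi> k) 1) = (\<Sum>l<m. if l = k then A l else 0)"
      unfolding h_def using \<phi> that by (intro sum.cong) (auto simp: axis_def inj_on_eq_iff)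
    then show ?thesis using that by simp
  qed
  have "W \<noteq> {0}"
    using axis_W[OF ij(1)] by (auto simp: axis_eq_0_iff)
  \<comment> \<open>Testing criticality against the coordinate vectors of \<open>W\<close> yields
    the rows of the eigenvalue equation for the Gram matrix.\<close>
  have sv: "norm (h w) \<in> ?S" if w: "w \<in> W" "norm w = 1"
    and crit: "\<And>u. u \<in> W \<Longrightarrow> h w \<bullet> h u = (norm (h w))\<^sup>2 * (w \<bullet> u)" for w
  proof -
    have "\<exists>k<m. w $ \<phi> k \<noteq> 0"
    proof (rule ccontr)
      assume "\<not> ?thesis"
      then have "w $ k = 0" for k
        using w(1) by (cases "k \<in> \<phi> ` {..<m}") (auto simp: W_def)
      then have "w = 0"
        by (simp add: vec_eq_iff)
      then show False using w(2) by simp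
    qed
    moreover have "(\<Sum>l<m. (A k \<bullet> A l) * w $ \<phi> l) = (norm (h w))\<^sup>2 * w $ \<phi> k" if "k < m" for k
    proof -
      have "A k \<bullet> h w = (norm (h w))\<^sup>2 * w $ \<phi> k"
        using crit[OF axis_W[OF that]] by (simp add: h_axis[OF that] inner_axis inner_commute)
      then show ?thesis by (simp add: h_def inner_sum_columns[of A])
    qed
    ultimately show ?thesis
      unfolding singular_values_def by (auto intro!: exI[of _ "\<lambda>k. w $ \<phi> k"])
  qed
  obtain w where w: "w \<in> W" "norm w = 1"
    "\<And>v. v \<in> W \<Longrightarrow> 0 \<le> 1 * ((norm (h v))\<^sup>2 - (norm (h w))\<^sup>2 * (norm v)\<^sup>2)"
    "\<And>u. u \<in> W \<Longrightarrow> h w \<bullet> h u = (norm (h w))\<^sup>2 * (w \<bullet> u)"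
    by (rule Rayleigh_extremal[OF h W \<open>W \<noteq> {0}\<close>, of 1]) auto
  obtain y where y: "y \<in> W" "norm y = 1"
    "\<And>v. v \<in> W \<Longrightarrow> 0 \<le> (-1) * ((norm (h v))\<^sup>2 - (norm (h y))\<^sup>2 * (norm v)\<^sup>2)"
    "\<And>u. u \<in> W \<Longrightarrow> h y \<bullet> h u = (norm (h y))\<^sup>2 * (y \<bullet> u)"
    by (rule Rayleigh_extremal[OF h W \<open>W \<noteq> {0}\<close>, of "-1"]) auto
  have fin: "finite ?S" by (rule finite_pos_singular_values(1)[OF A])
  have wS: "norm (h w) \<in> ?S" and yS: "norm (h y) \<in> ?S"
    using sv w y by blast+
  \<comment> \<open>Membership suffices: the extreme stretch factors need not be identified with
    \<open>Min\<close> and \<open>Max\<close>, only compared in these directions.\<close>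
  have Min_le: "Min ?S \<le> norm (h w)" using fin wS by simp
  have le_Max: "norm (h y) \<le> Max ?S" using fin yS by simp
  have Min_pos: "0 < Min ?S"
    using fin wS finite_pos_singular_values(2)[OF A] Min_in by blast
  define v where "v = (\<chi> k. if k \<in> \<phi> ` {..<m} then c (the_inv_into {..<m} \<phi> k) else 0)"
  have v: "v \<in> W" by (simp add: v_def W_def)
  have v_nth: "v $ \<phi> k = c k" if "k < m" for k
    using that \<phi> by (simp add: v_def the_inv_into_f_f)
  have h_v: "h v = (\<Sum>k<m. c k *\<^sub>R A k)"
    by (simp add: h_def v_nth)
  have "(norm (h w) * norm v)\<^sup>2 \<le> (norm (h v))\<^sup>2"
    using w(3)[OF v] by (simp add: power_mult_distrib)
  then have "norm (h w) * norm v \<le> norm (h v)"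
    by (rule power2_le_imp_le) simp
  moreover have "Min ?S * \<bar>c j\<bar> \<le> norm (h w) * norm v"
    using component_le_norm_cart[of v "\<phi> j"] Min_le Min_pos v_nth[OF ij(2)]
    by (intro mult_mono) auto
  ultimately have lower: "Min ?S * \<bar>c j\<bar> \<le> norm (h v)" by linarith
  have "(norm (A i))\<^sup>2 \<le> (norm (h y))\<^sup>2"
    using y(3)[OF axis_W[OF ij(1)]] by (simp add: h_axis ij)
  then have "norm (A i) \<le> norm (h y)"
    by (rule power2_le_imp_le) simp
  then have "norm (A i) * \<bar>c j\<bar> \<le> Max ?S * \<bar>c j\<bar>"
    using le_Max by (intro mult_right_mono) auto
  also have "\<dots> = cond_number m A * (Min ?S * \<bar>c j\<bar>)"
    using Min_pos by (simp add: cond_number_def)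
  also have "\<dots> \<le> cond_number m A * norm (h v)"
    using lower order_trans[OF norm_ge_zero le_Max] Min_pos
    by (intro mult_left_mono) (simp_all add: cond_number_def)
  finally show ?thesis by (simp add: h_v)
qed

section \<open>One step of the method\<close>

text \<open>On a short multiple \<open>r *\<^sub>R v\<close> the derivative differs from an
  increment of \<open>g\<close> by a small relative error; dividing by \<open>r\<close> leaves an
  arbitrary \<open>e\<close>.\<close>

lemma Lipschitz_imp_derivative_bound:
  fixes g :: "'a::real_normed_vector \<Rightarrow> 'b::real_normed_vector"
  assumes der: "(g has_derivative G) (at x)"
    and lip: "\<And>x y. norm (g x - g y) \<le> \<kappa> * norm (x - y)"
  shows "norm (G v) \<le> \<kappa> * norm v"
proof (cases "v = 0")
  case True
  then show ?thesis
    using der has_derivative_bounded_linear linear_simps(3) by fastforce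
next
  case False
  have "norm (G v) \<le> \<kappa> * norm v + e" if "e > 0" for e
  proof -
    have "0 < e / norm v" using that False by simp
    then obtain d where "d > 0"
      and d: "\<And>y. norm (y - x) < d \<Longrightarrow> norm (g y - g x - G (y - x)) \<le> e / norm v * norm (y - x)"
      using der unfolding has_derivative_at_alt by meson
    define r where "r = d / (2 * norm v)"
    have r: "r > 0" "r * norm v < d"
      using \<open>d > 0\<close> False by (auto simp: r_def field_simps)
    have "G (r *\<^sub>R v) = r *\<^sub>R G v"
      using der has_derivative_bounded_linear linear_simps(5) by blast
    then have "norm (r *\<^sub>R G v) \<le> norm (g (x + r *\<^sub>R v) - g x)
        + norm (g (x + r *\<^sub>R v) - g x - G (r *\<^sub>R v))"
      using norm_triangle_ineq4[of "g (x + r *\<^sub>R v) - g x" "g (x + r *\<^sub>R v) - g x - G (r *\<^sub>R v)"]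
      by simp
    also have "\<dots> \<le> \<kappa> * norm (r *\<^sub>R v) + e / norm v * norm (r *\<^sub>R v)"
      using lip[of "x + r *\<^sub>R v" x] d[of "x + r *\<^sub>R v"] r by (intro add_mono) auto
    also have "\<dots> = r * (\<kappa> * norm v + e)"
      using False r by (simp add: field_simps)
    finally show ?thesis using r by simp
  qed
  then show ?thesis by (rule field_le_epsilon)
qed

text \<open>Mean value inequality on the ball around \<open>x\<close>, where the derivative varies
  by at most \<open>\<gamma> * r\<close>. The base point \<open>x\<close> need not be an endpoint,
  so all inner steps can share the one matrix \<open>g' x\<close>.\<close>

lemma linearization_bound:
  fixes g :: "real ^ 'n \<Rightarrow> real ^ 'n"
  assumes der: "\<And>x. (g has_derivative (*v) (g' x)) (at x)"
    and dlip: "\<And>x y. onorm ((*v) (g' x - g' y)) \<le> \<gamma> * norm (x - y)"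
    and \<gamma>: "0 \<le> \<gamma>"
    and u: "norm (u - x) \<le> r" and v: "norm (v - x) \<le> r"
  shows "norm (g v - g u - g' x *v (v - u)) \<le> \<gamma> * r * norm (v - u)"
proof -
  have "norm (g v - g u - g' x *v (v - u)) \<le> norm (v - u) * (\<gamma> * r)"
  proof (rule differentiable_bound_linearization
        [where S = "cball x r" and f' = "\<lambda>y. (*v) (g' y)" and ?x0.0 = x])
    show "u + t *\<^sub>R (v - u) \<in> cball x r" if "t \<in> {0..1}" for t
      using convexD_alt[OF convex_cball, of u x r v t] u v that
      by (simp add: dist_norm norm_minus_commute algebra_simps)
    show "(g has_derivative (*v) (g' y)) (at y within cball x r)" for y
      using der by (rule has_derivative_at_withinI)
    show "onorm ((*v) (g' y) - (*v) (g' x)) \<le> \<gamma> * r" if "y \<in> cball x r" for y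
    proof -
      have "(*v) (g' y) - (*v) (g' x) = (*v) (g' y - g' x)"
        by (auto simp: matrix_vector_mult_diff_rdistrib)
      then have "onorm ((*v) (g' y) - (*v) (g' x)) \<le> \<gamma> * norm (y - x)"
        using dlip[of y x] by simp
      also have "\<dots> \<le> \<gamma> * r"
        using that \<gamma> by (intro mult_left_mono) (auto simp: dist_norm norm_minus_commute)
      finally show ?thesis .
    qed
    show "x \<in> cball x r"
      using order_trans[OF norm_ge_zero u] by simp
  qed
  then show ?thesis by (simp add: mult_ac)
qed

text \<open>Abel summation by induction: a new index raises every tail sum by
  \<open>a (Suc m)\<close>, and the extra differences telescope.\<close>

lemma weighted_sum_eq_differences:
  fixes z :: "nat \<Rightarrow> 'a::real_vector"
  shows "(\<Sum>l\<le>m. a l *\<^sub>R z l)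
    = (\<Sum>l\<le>m. a l) *\<^sub>R z 0 + (\<Sum>j<m. (\<Sum>l\<in>{j<..m}. a l) *\<^sub>R (z (Suc j) - z j))"
proof (induction m)
  case 0
  then show ?case by simp
next
  case (Suc m)
  have "(\<Sum>l\<in>{j<..Suc m}. a l) = (\<Sum>l\<in>{j<..m}. a l) + a (Suc m)" if "j \<le> m" for j
  proof -
    have "{j<..Suc m} = insert (Suc m) {j<..m}" using that by auto
    then show ?thesis by simp
  qed
  then have "(\<Sum>j<Suc m. (\<Sum>l\<in>{j<..Suc m}. a l) *\<^sub>R (z (Suc j) - z j))
    = (\<Sum>j<Suc m. (\<Sum>l\<in>{j<..m}. a l) *\<^sub>R (z (Suc j) - z j) + a (Suc m) *\<^sub>R (z (Suc j) - z j))"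
    by (intro sum.cong) (auto simp: scaleR_add_left)
  \<comment> \<open>The term \<open>j = m\<close> of the old tails drops out because
    \<open>{m<..m}\<close> is empty.\<close>
  also have "\<dots> = (\<Sum>j<m. (\<Sum>l\<in>{j<..m}. a l) *\<^sub>R (z (Suc j) - z j)) + a (Suc m) *\<^sub>R (z (Suc m) - z 0)"
    by (simp add: sum.distrib flip: scaleR_sum_right sum_lessThan_telescope)
  finally show ?case
    using Suc.IH by (simp add: algebra_simps)
qed

section \<open>Optimal weights and the next residual\<close>

lemma aap_weightsD:
  assumes "aap_weights g m x a"
  shows "(\<Sum>l\<le>m. a l) = 1" "norm (mixed_residual g m x a) \<le> norm (residual g x)"
proof -
  have a: "(\<Sum>l\<le>m. a l) = 1"
    and min: "\<And>c. (\<Sum>l\<le>m. c l) = 1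
      \<Longrightarrow> (norm (mixed_residual g m x a))\<^sup>2 \<le> (norm (mixed_residual g m x c))\<^sup>2"
    using assms by (auto simp: aap_weights_def is_arg_min_linorder)
  show "(\<Sum>l\<le>m. a l) = 1" by (rule a)
  \<comment> \<open>Competitor for the minimality: all weight on the starting point.\<close>
  let ?e = "\<lambda>l. if l = 0 then 1 else 0 :: real"
  have "mixed_residual g m x ?e = (\<Sum>l\<le>m. if l = 0 then residual g x else 0)"
    unfolding mixed_residual_def by (intro sum.cong) auto
  also have "\<dots> = residual g x" by simp
  finally have "(norm (mixed_residual g m x a))\<^sup>2 \<le> (norm (residual g x))\<^sup>2"
    using min[of ?e] by simp
  then show "norm (mixed_residual g m x a) \<le> norm (residual g x)"
    by (rule power2_le_imp_le) simp
qed

text \<open>The first term is the contraction governed by the gain; the second is the nonlinearity,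
  quadratic in the residual. The absolute value accounts for damping ratios above
  \<open>1\<close>.\<close>

lemma residual_aap_step:
  fixes g :: "real ^ 'n \<Rightarrow> real ^ 'n"
  assumes der: "\<And>x. (g has_derivative (*v) (g' x)) (at x)"
    and lip: "\<And>x y. norm (g x - g y) \<le> \<kappa> * norm (x - y)"
    and \<kappa>: "0 \<le> \<kappa>" "\<kappa> < 1"
    and dlip: "\<And>x y. onorm ((*v) (g' x - g' y)) \<le> \<gamma> * norm (x - y)"
    and \<gamma>: "0 \<le> \<gamma>"
    and rank: "full_column_rank m (S_cols g x)"
    and cond: "cond_number m (S_cols g x) \<le> N" and N: "0 \<le> N"
    and weights: "aap_weights g m x a"
    and b: "0 \<le> b"
    and small: "\<gamma> * (real m)\<^sup>2 * N * norm (residual g x) \<le> (1 - \<kappa>) / 2"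
  shows "norm (residual g (aap_step g m b x a))
    \<le> (\<bar>1 - b\<bar> + b * \<kappa>) * norm (mixed_residual g m x a)
      + (16 * \<gamma> / (1 - \<kappa>)\<^sup>2 + 4 * \<gamma> * (real m)\<^sup>2 * N / (1 - \<kappa>)) * (norm (residual g x))\<^sup>2"
proof -
  define F where "F = norm (residual g x)"
  define p where "p = (\<lambda>l. (g ^^ l) x)"
  define s where "s = S_cols g x"
  define c where "c j = (\<Sum>l\<in>{j<..m}. a l)" for j
  define xb where "xb = (\<Sum>l\<le>m. a l *\<^sub>R p l)"
  define fb where "fb = mixed_residual g m x a"
  define Sc where "Sc = (\<Sum>j<m. c j *\<^sub>R s j)"
  define err where "err j = g (p (Suc j)) - g (p j) - g' x *v s j" for j
  define R where "R = (\<Sum>j<m. c j *\<^sub>R err j)"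
  define E where "E = g xb - (\<Sum>l\<le>m. a l *\<^sub>R g (p l))"
  note a = aap_weightsD[OF weights]
  have p0: "p 0 = x" and pSuc: "p (Suc l) = g (p l)" for l by (simp_all add: p_def)
  have s: "s j = p (Suc j) - p j" for j by (simp add: s_def S_cols_def p_def)
  have expand: "(\<Sum>l\<le>m. a l *\<^sub>R z l) = z 0 + (\<Sum>j<m. c j *\<^sub>R (z (Suc j) - z j))"
    for z :: "nat \<Rightarrow> real ^ 'n"
    using weighted_sum_eq_differences[where a = a and z = z and m = m] by (simp add: a(1) c_def)
  have F: "0 \<le> F" by (simp add: F_def)
  have norm_s: "norm (s j) \<le> F" for j
  proof (induction j)
    case 0
    then show ?case by (simp add: s p_def F_def residual_def)
  next
    case (Suc j)
    have "norm (s (Suc j)) \<le> \<kappa> * norm (s j)"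
      using lip by (simp add: s pSuc)
    also have "\<dots> \<le> norm (s j)"
      using \<kappa> by (intro mult_left_le_one_le) auto
    finally show ?case using Suc by simp
  qed
  have dist_p: "norm (p j - x) \<le> real j * F" for j
  proof (induction j)
    case 0
    then show ?case by (simp add: p0)
  next
    case (Suc j)
    have "norm (p (Suc j) - x) \<le> norm (s j) + norm (p j - x)"
      using norm_triangle_ineq[of "s j" "p j - x"] by (simp add: s)
    then show ?case using Suc norm_s[of j] by (simp add: algebra_simps)
  qed
  have dist_p': "norm (p j - x) \<le> real m * F" if "j \<le> m" for j
    using dist_p[of j] that F by (meson mult_right_mono of_nat_mono order_trans)
  \<comment> \<open>The linearization error carries a factor \<open>norm (s j)\<close>; paired with
    \<open>\<bar>c j\<bar>\<close> it is controlled by the condition number, so the coefficients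
    never need a bound of their own.\<close>
  have "norm (c j *\<^sub>R err j) \<le> \<gamma> * real m * F * (N * norm Sc)" if j: "j < m" for j
  proof -
    have "norm (err j) \<le> \<gamma> * (real m * F) * norm (s j)"
      unfolding err_def s using dist_p' j
      by (intro linearization_bound[OF der dlip \<gamma>]) auto
    then have "\<bar>c j\<bar> * norm (err j) \<le> \<bar>c j\<bar> * (\<gamma> * (real m * F) * norm (s j))"
      by (rule mult_left_mono) simp
    also have "\<dots> = \<gamma> * real m * F * (norm (s j) * \<bar>c j\<bar>)"
      by (simp add: mult_ac)
    also have "\<dots> \<le> \<gamma> * real m * F * (cond_number m s * norm Sc)"
      using cond_number_bound[OF rank j j, of c] \<gamma> F
      by (intro mult_left_mono) (auto simp: s_def Sc_def)
    also have "\<dots> \<le> \<gamma> * real m * F * (N * norm Sc)"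
      using cond \<gamma> F by (intro mult_left_mono mult_right_mono) (auto simp: s_def)
    finally show ?thesis by simp
  qed
  then have "norm R \<le> real (card {..<m}) * (\<gamma> * real m * F * (N * norm Sc))"
    unfolding R_def by (intro order_trans[OF norm_sum] sum_bounded_above) auto
  then have R: "norm R \<le> \<gamma> * (real m)\<^sup>2 * N * F * norm Sc"
    by (simp add: power2_eq_square mult_ac)
  have GSc: "g' x *v Sc = (\<Sum>j<m. c j *\<^sub>R (g' x *v s j))"
    by (simp add: Sc_def linear_sum[OF matrix_vector_mul_linear] matrix_vector_mult_scaleR)
  have gp: "(\<Sum>l\<le>m. a l *\<^sub>R g (p l)) = g x + g' x *v Sc + R"
    unfolding expand R_def GSc p0 by (simp add: err_def flip: sum.distrib scaleR_add_right)
  have xb: "xb = x + Sc"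
    unfolding xb_def expand Sc_def s p0 ..
  have fb: "fb = (\<Sum>l\<le>m. a l *\<^sub>R g (p l)) - xb"
    by (simp add: fb_def mixed_residual_def residual_def xb_def p_def scaleR_diff_right sum_subtractf)
  have Sc: "norm Sc \<le> 4 * F / (1 - \<kappa>)"
  proof -
    \<comment> \<open>Solved for \<open>Sc\<close>, this can be absorbed: \<open>\<kappa>\<close>
      from the derivative and \<open>(1 - \<kappa>) / 2\<close> from \<open>R\<close> leave
      \<open>(1 - \<kappa>) / 2\<close> on the left against \<open>2 * F\<close>.\<close>
    have "Sc = g' x *v Sc + R - fb + residual g x"
      unfolding fb gp xb residual_def by simp
    then have "norm Sc \<le> norm (g' x *v Sc) + norm R + norm fb + norm (residual g x)"
      by (smt (verit) norm_triangle_ineq norm_triangle_ineq4)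
    also have "\<dots> \<le> \<kappa> * norm Sc + (1 - \<kappa>) / 2 * norm Sc + F + F"
      using Lipschitz_imp_derivative_bound[OF der lip, of x Sc] a(2)
        order_trans[OF R mult_right_mono[OF small[folded F_def] norm_ge_zero]]
      by (intro add_mono) (auto simp: F_def fb_def)
    finally show ?thesis using \<kappa> by (simp add: field_simps)
  qed
  \<comment> \<open>Both parts of \<open>E\<close> are linearized at \<open>x\<close>, so the matrix
    terms cancel and only two remainders survive.\<close>
  have "E = (g xb - g x - g' x *v (xb - x)) - R"
    unfolding E_def gp by (simp add: xb)
  then have "norm E \<le> norm (g xb - g x - g' x *v (xb - x)) + norm R"
    by (simp add: norm_triangle_ineq4)
  also have "\<dots> \<le> \<gamma> * norm Sc * norm Sc + \<gamma> * (real m)\<^sup>2 * N * F * norm Sc"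
    using linearization_bound[OF der dlip \<gamma>, of x x "norm Sc" xb] R
    by (intro add_mono) (auto simp: xb)
  also have "\<dots> \<le> \<gamma> * (4 * F / (1 - \<kappa>)) * (4 * F / (1 - \<kappa>))
      + \<gamma> * (real m)\<^sup>2 * N * F * (4 * F / (1 - \<kappa>))"
    using Sc \<gamma> N F \<kappa> by (intro add_mono mult_mono mult_left_mono) auto
  also have "\<dots> = (16 * \<gamma> / (1 - \<kappa>)\<^sup>2 + 4 * \<gamma> * (real m)\<^sup>2 * N / (1 - \<kappa>)) * F\<^sup>2"
    using \<kappa> by (simp add: field_simps power2_eq_square)
  finally have E: "norm E \<le> \<dots>" .
  have step: "aap_step g m b x a = xb + b *\<^sub>R fb"
    unfolding fb by (simp add: aap_step_def xb_def p_def algebra_simps)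
  have "residual g (aap_step g m b x a) = (1 - b) *\<^sub>R fb + (g (xb + b *\<^sub>R fb) - g xb) + E"
    unfolding step residual_def E_def using fb by (simp add: algebra_simps)
  then have "norm (residual g (aap_step g m b x a))
      \<le> norm ((1 - b) *\<^sub>R fb) + norm (g (xb + b *\<^sub>R fb) - g xb) + norm E"
    by (metis (no_types, opaque_lifting) add_right_mono norm_triangle_ineq order_trans)
  also have "\<dots> \<le> \<bar>1 - b\<bar> * norm fb + \<kappa> * (b * norm fb) + norm E"
    using lip[of "xb + b *\<^sub>R fb" xb] b by simp
  finally show ?thesis
    using E by (simp add: fb_def F_def algebra_simps)
qed

text \<open>The radius is fixed before the trajectory, so it may depend on constants only:
  \<open>C\<close> bounds the condition numbers of the early steps uniformly, and \<open>q\<close>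
  leaves the slack \<open>\<rho> - q\<close> to absorb the quadratic term.\<close>

theorem theorem5p5:
  fixes g :: "real ^ 'n \<Rightarrow> real ^ 'n"
    and g' :: "real ^ 'n \<Rightarrow> real ^ 'n ^ 'n"
    and xstar :: "real ^ 'n"
    and m :: nat
    and \<kappa> \<gamma> \<beta> T M C q \<rho> :: real
  assumes "\<And>x. (g has_derivative (*v) (g' x)) (at x)"
    and "continuous_on UNIV g'"
    and "\<And>x y. norm (g x - g y) \<le> \<kappa> * norm (x - y)"
    and "\<kappa> < 1"
    and "\<And>x y. onorm ((*v) (g' x - g' y)) \<le> \<gamma> * norm (x - y)"
    and "\<gamma> > 0"
    and "1 \<le> m" and "m \<le> CARD('n)"
    and "\<beta> > 0" and "T > 0" and "M > 0"
    and "xstar = g xstar"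
    and "q < \<rho>" and "\<rho> < 1"
  shows "\<exists>\<delta>>0. \<forall>x b \<alpha>.
           norm (x 0 - xstar) < \<delta> \<and>
           aap_sequence g m b \<alpha> x \<and>
           (\<forall>t. \<beta> \<le> b t) \<and>
           (\<forall>t. full_column_rank m (S_cols g (x t)) \<and> full_column_rank m (Y_cols g (x t))) \<and>
           (\<forall>t. real t > T \<longrightarrow> cond_number m (S_cols g (x t)) \<le> M) \<and>
           (\<forall>t. real t \<le> T \<longrightarrow> cond_number m (S_cols g (x t)) \<le> C) \<and>
           (SUP t. ereal ((\<bar>1 - b t\<bar> + b t * \<kappa>) * gain g m (x t) (\<alpha> t))) \<le> ereal q
           \<longrightarrow>
           residual g xstar = 0 \<and>
           (\<lambda>t. residual g (x t)) \<longlonglongrightarrow> residual g xstar \<and>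
           (\<forall>t. norm (residual g (x (Suc t))) \<le> \<rho> * norm (residual g (x t)))"
proof -
  note der = assms(1) and lip = assms(3) and dlip = assms(5)
  define N where "N = max M C"
  have N: "0 < N" using \<open>M > 0\<close> by (simp add: N_def)
  \<comment> \<open>The Lipschitz bound for a unit vector and \<open>0\<close> shows that
    \<open>\<kappa>\<close> is nonnegative.\<close>
  have "0 \<le> \<kappa> * norm (axis undefined 1 :: real ^ 'n)"
    using order_trans[OF norm_ge_zero lip[of "axis undefined 1" 0]] by simp
  then have \<kappa>: "0 \<le> \<kappa>" by simp
  define K where "K = 16 * \<gamma> / (1 - \<kappa>)\<^sup>2 + 4 * \<gamma> * (real m)\<^sup>2 * N / (1 - \<kappa>)"
  have K: "0 < K"
    unfolding K_def using assms(4,6,7) N by (intro add_pos_nonneg) auto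
  define P where "P = \<gamma> * (real m)\<^sup>2 * N"
  have P: "0 < P" unfolding P_def using assms(6,7) N by simp
  \<comment> \<open>The first bound is the smallness condition of the one-step estimate; the second
    keeps \<open>K\<close> times the squared residual below \<open>\<rho> - q\<close> times the
    residual.\<close>
  define \<epsilon> where "\<epsilon> = min ((1 - \<kappa>) / 2 / P) ((\<rho> - q) / K)"
  have \<epsilon>: "0 < \<epsilon>" using assms(4) P K \<open>q < \<rho>\<close> by (simp add: \<epsilon>_def)
  have res0: "residual g xstar = 0" using assms(12) by (simp add: residual_def)
  have main: "norm (residual g (x t)) \<le> \<rho> ^ t * norm (residual g (x 0))
      \<and> norm (residual g (x (Suc t))) \<le> \<rho> * norm (residual g (x t)) \<and> 0 \<le> \<rho>"
    if x0: "norm (x 0 - xstar) < \<epsilon> / 2" and seq: "aap_sequence g m b \<alpha> x"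
      and rank: "\<forall>t. full_column_rank m (S_cols g (x t))"
      and cond: "\<forall>t. real t > T \<longrightarrow> cond_number m (S_cols g (x t)) \<le> M"
        "\<forall>t. real t \<le> T \<longrightarrow> cond_number m (S_cols g (x t)) \<le> C"
      and SUP: "(SUP t. ereal ((\<bar>1 - b t\<bar> + b t * \<kappa>) * gain g m (x t) (\<alpha> t))) \<le> ereal q"
    for x b \<alpha> t
  proof -
    have b: "0 \<le> b t" and weights: "aap_weights g m (x t) (\<alpha> t)"
      and x_Suc: "x (Suc t) = aap_step g m (b t) (x t) (\<alpha> t)" for t
      using seq by (auto simp: aap_sequence_def)
    have cond_N: "cond_number m (S_cols g (x t)) \<le> N" for t
      using cond by (cases "real t > T") (auto simp: N_def le_max_iff_disj)
    have gain_le: "(\<bar>1 - b t\<bar> + b t * \<kappa>) * gain g m (x t) (\<alpha> t) \<le> q" for t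
      using SUP by (simp add: SUP_le_iff)
    \<comment> \<open>The sign of \<open>\<rho>\<close> comes from the existence of a trajectory:
      gains are nonnegative and bounded through \<open>q\<close>.\<close>
    have "0 \<le> (\<bar>1 - b 0\<bar> + b 0 * \<kappa>) * gain g m (x 0) (\<alpha> 0)"
      using b \<kappa> by (simp add: gain_def)
    then have \<rho>: "0 \<le> \<rho>"
      using gain_le[of 0] \<open>q < \<rho>\<close> by linarith
    have step: "norm (residual g (x (Suc t))) \<le> \<rho> * norm (residual g (x t))"
      if F: "norm (residual g (x t)) \<le> \<epsilon>" for t
    proof -
      let ?F = "norm (residual g (x t))"
      have small: "P * ?F \<le> (1 - \<kappa>) / 2" and KF: "K * ?F \<le> \<rho> - q"
        using F P K by (auto simp: \<epsilon>_def pos_le_divide_eq mult_ac)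
      \<comment> \<open>If the residual vanishes then so does the mixed one, so the junk value \<open>gain = 0\<close> is harmless.\<close>
      have "norm (mixed_residual g m (x t) (\<alpha> t)) = gain g m (x t) (\<alpha> t) * ?F"
        using aap_weightsD(2)[OF weights, of t] by (auto simp: gain_def)
      then have "(\<bar>1 - b t\<bar> + b t * \<kappa>) * norm (mixed_residual g m (x t) (\<alpha> t)) \<le> q * ?F"
        using mult_right_mono[OF gain_le[of t] norm_ge_zero[of "residual g (x t)"]]
        by (simp add: mult.assoc)
      moreover have "norm (residual g (x (Suc t)))
          \<le> (\<bar>1 - b t\<bar> + b t * \<kappa>) * norm (mixed_residual g m (x t) (\<alpha> t)) + K * ?F\<^sup>2"
        unfolding x_Suc K_def
        using rank cond_N weights b N \<kappa> \<open>\<kappa> < 1\<close> \<open>\<gamma> > 0\<close> small[unfolded P_def]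
        by (intro residual_aap_step[OF der lip _ _ dlip]) auto
      moreover have "K * ?F\<^sup>2 \<le> (\<rho> - q) * ?F"
        using mult_right_mono[OF KF norm_ge_zero[of "residual g (x t)"]]
        by (simp add: power2_eq_square mult.assoc)
      ultimately show ?thesis by (simp add: algebra_simps)
    qed
    \<comment> \<open>The residual is at most \<open>1 + \<kappa> \<le> 2\<close> times the distance
      to \<open>xstar\<close>, hence the radius \<open>\<epsilon> / 2\<close>.\<close>
    have "norm (residual g (x 0)) = norm ((g (x 0) - g xstar) - (x 0 - xstar))"
      using assms(12) by (simp add: residual_def)
    also have "\<dots> \<le> \<kappa> * norm (x 0 - xstar) + norm (x 0 - xstar)"
      using lip[of "x 0" xstar] norm_triangle_ineq4[of "g (x 0) - g xstar" "x 0 - xstar"] by linarith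
    also have "\<dots> \<le> 2 * norm (x 0 - xstar)"
      using mult_right_mono[of \<kappa> 1 "norm (x 0 - xstar)"] \<open>\<kappa> < 1\<close> by simp
    finally have F0: "norm (residual g (x 0)) \<le> \<epsilon>"
      using x0 by simp
    \<comment> \<open>The bound by \<open>\<epsilon>\<close> is carried along so that the one-step
      contraction stays applicable.\<close>
    have decay: "norm (residual g (x t)) \<le> \<rho> ^ t * norm (residual g (x 0))
        \<and> norm (residual g (x t)) \<le> \<epsilon>" for t
    proof (induction t)
      case 0
      then show ?case using F0 by simp
    next
      case (Suc t)
      have "norm (residual g (x (Suc t))) \<le> \<rho> * (\<rho> ^ t * norm (residual g (x 0)))"
        using step Suc \<rho> by (meson mult_left_mono order_trans)
      moreover have "\<rho> * norm (residual g (x t)) \<le> norm (residual g (x t))"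
        using \<rho> \<open>\<rho> < 1\<close> by (intro mult_left_le_one_le) auto
      ultimately show ?case using step Suc by (fastforce simp: mult.assoc)
    qed
    show ?thesis using decay step \<rho> by blast
  qed
  show ?thesis
  proof (intro exI[of _ "\<epsilon> / 2"] conjI allI impI)
    show "0 < \<epsilon> / 2" using \<epsilon> by simp
  next
    show "residual g xstar = 0" by (rule res0)
  next
    fix x b \<alpha> t
    assume "norm (x 0 - xstar) < \<epsilon> / 2 \<and>
      aap_sequence g m b \<alpha> x \<and>
      (\<forall>t. \<beta> \<le> b t) \<and>
      (\<forall>t. full_column_rank m (S_cols g (x t)) \<and> full_column_rank m (Y_cols g (x t))) \<and>
      (\<forall>t. real t > T \<longrightarrow> cond_number m (S_cols g (x t)) \<le> M) \<and>
      (\<forall>t. real t \<le> T \<longrightarrow> cond_number m (S_cols g (x t)) \<le> C) \<and>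
      (SUP t. ereal ((\<bar>1 - b t\<bar> + b t * \<kappa>) * gain g m (x t) (\<alpha> t))) \<le> ereal q"
    then have decay: "norm (residual g (x t)) \<le> \<rho> ^ t * norm (residual g (x 0))
        \<and> norm (residual g (x (Suc t))) \<le> \<rho> * norm (residual g (x t)) \<and> 0 \<le> \<rho>" for t
      by (intro main) blast+
    show "norm (residual g (x (Suc t))) \<le> \<rho> * norm (residual g (x t))"
      using decay by blast
    have "(\<lambda>t. \<rho> ^ t * norm (residual g (x 0))) \<longlonglongrightarrow> 0"
      using decay \<open>\<rho> < 1\<close> by (intro tendsto_mult_left_zero LIMSEQ_power_zero) auto
    then have "(\<lambda>t. residual g (x t)) \<longlonglongrightarrow> 0"
      by (rule Lim_null_comparison[rotated]) (use decay in auto)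
    then show "(\<lambda>t. residual g (x t)) \<longlonglongrightarrow> residual g xstar"
      by (simp add: res0)
  qed
qed

end
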